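(* Let $X$ be an infinite metrizable space and let $Y$ be a subspace of $X$. If TWO has a winning strategy in the game $\mathsf{G}_d^{\omega}(\mathcal{O},\mathcal{O}_Y)$ on $X$, then $Y$ is a subset of a union of countably many closed, strongly zero-dimensional subsets of $X$.
   Context: A space is strongly zero-dimensional (equivalently, has covering dimension zero) if each finite open cover of it has a refinement by disjoint open sets which still covers the space; for subsets of $X$ this refers to the subspace topology. A collection $\mathcal{A}$ of subsets of a topological space $X$ is discrete if each $x\in X$ has a neighborhood $U$ with $|\{A\in\mathcal{A}: A\cap U\neq\emptyset\}|\le 1$. A family $\mathcal{A}$ of sets refines a family $\mathcal{B}$ if each $A\in\mathcal{A}$ is a subset of some $B\in\mathcal{B}$ (no covering requirement). $\mathcal{O}$ is the collection of all open covers of $X$; for $Y\subseteq X$, $\mathcal{O}_Y$ is the collection of covers of $Y$ by sets open in $X$. Game $\mathsf{G}^{\omega}_d(\mathcal{O},\mathcal{O}_Y)$ on $X$: in each inning $n<\omega$, ONE first selects $A_n\in\mathcal{O}$, and TWO responds with a discrete (in $X$) family $B_n$ of subsets of $X$ refining $A_n$. TWO wins the play if $\bigcup\{B_n:n<\omega\}\in\mathcal{O}_Y$; otherwise ONE wins. A winning strategy for TWO is a (perfect information) strategy such that TWO wins every play in which TWO follows it. *)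

theory Defs
  imports "HOL-Analysis.Analysis"
begin

text \<open>\<open>open_cover X Y\<close> is the class of covers of \<open>Y\<close> by sets open in \<open>X\<close>; the open covers of the space
  itself are the case \<open>Y = topspace X\<close>.\<close>

definition open_cover :: "'a topology \<Rightarrow> 'a set \<Rightarrow> 'a set set \<Rightarrow> bool" where
  "open_cover X Y \<U> \<longleftrightarrow> (\<forall>U\<in>\<U>. openin X U) \<and> Y \<subseteq> \<Union>\<U>"

text \<open>Finiteness is stated separately because \<open>card\<close> is 0 on infinite sets.\<close>

definition discrete_family :: "'a topology \<Rightarrow> 'a set set \<Rightarrow> bool" where
  "discrete_family X \<A> \<longleftrightarrow> \<Union>\<A> \<subseteq> topspace X \<and>
     (\<forall>x\<in>topspace X. \<exists>U. openin X U \<and> x \<in> U \<and>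
        finite {A \<in> \<A>. A \<inter> U \<noteq> {}} \<and> card {A \<in> \<A>. A \<inter> U \<noteq> {}} \<le> 1)"

definition refines :: "'a set set \<Rightarrow> 'a set set \<Rightarrow> bool" where
  "refines \<A> \<B> \<longleftrightarrow> (\<forall>A\<in>\<A>. \<exists>B\<in>\<B>. A \<subseteq> B)"

definition strongly_zero_dimensional :: "'a topology \<Rightarrow> bool" where
  "strongly_zero_dimensional X \<longleftrightarrow>
     (\<forall>\<U>. finite \<U> \<and> open_cover X (topspace X) \<U> \<longrightarrow>
        (\<exists>\<V>. open_cover X (topspace X) \<V> \<and> pairwise disjnt \<V> \<and> refines \<V> \<U>))"

definition legal_one :: "'a topology \<Rightarrow> 'a set set \<Rightarrow> bool" where
  "legal_one X A \<longleftrightarrow> open_cover X (topspace X) A"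

text \<open>The members of TWO's family need not be open; openness enters only through the winning condition.\<close>

definition legal_two :: "'a topology \<Rightarrow> 'a set set \<Rightarrow> 'a set set \<Rightarrow> bool" where
  "legal_two X A B \<longleftrightarrow> discrete_family X B \<and> refines B A"

text \<open>The argument of a strategy for TWO is the list of completed innings, oldest first, together
  with the move ONE has just made.\<close>

type_synonym 'a strategy =
  "('a set set \<times> 'a set set) list \<Rightarrow> 'a set set \<Rightarrow> 'a set set"

definition strategy_two :: "'a topology \<Rightarrow> 'a strategy \<Rightarrow> bool" where
  "strategy_two X \<sigma> \<longleftrightarrow>
     (\<forall>h A. (\<forall>(A', B') \<in> set h. legal_one X A' \<and> legal_two X A' B') \<and> legal_one X A
        \<longrightarrow> legal_two X A (\<sigma> h A))"

definition follows ::
  "'a strategy \<Rightarrow> (nat \<Rightarrow> 'a set set) \<Rightarrow> (nat \<Rightarrow> 'a set set) \<Rightarrow> bool" where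
  "follows \<sigma> A B \<longleftrightarrow> (\<forall>n. B n = \<sigma> (map (\<lambda>i. (A i, B i)) [0..<n]) (A n))"

definition winning_strategy_two :: "'a topology \<Rightarrow> 'a set \<Rightarrow> 'a strategy \<Rightarrow> bool" where
  "winning_strategy_two X Y \<sigma> \<longleftrightarrow> strategy_two X \<sigma> \<and>
     (\<forall>A B. (\<forall>n. legal_one X (A n)) \<and> follows \<sigma> A B \<longrightarrow> open_cover X Y (\<Union>n. B n))"

end

theory Submission
  imports Defs
begin

text \<open>Let ONE play only the covers \<open>\<O> m\<close> by balls of radius \<open>1/(m+1)\<close>, so that the histories \<open>s\<close>
  form a countable tree. If \<open>y \<in> Y\<close> were, after every history, missed by TWO's answer to some
  \<open>\<O> m\<close>, then ONE could win by always playing such a cover. So \<open>Y\<close> is contained in the union over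
  all \<open>s\<close> of the intersections over \<open>m\<close> of the sets covered by TWO's answer to \<open>\<O> m\<close> after \<open>s\<close>.
  Replacing these answers by their closures makes each of these countably many sets closed, and
  discreteness turns the closures of the members into a clopen partition of it. These partitions
  have mesh tending to zero, so every open cover is refined by cells of their successive common
  refinements, where each point takes the first cell that is small enough.\<close>

text \<open>Since the family of members meeting \<open>U\<close> is finite, the bound on
  \<open>card\<close> forces any two of them to coincide, which is the form used below.\<close>

lemma discrete_family_member_unique:
  assumes "discrete_family X B" "x \<in> topspace X"
  shows "\<exists>U. openin X U \<and> x \<in> U \<and>
    (\<forall>b\<in>B. \<forall>c\<in>B. b \<inter> U \<noteq> {} \<longrightarrow> c \<inter> U \<noteq> {} \<longrightarrow> b = c)"
proof -
  obtain U where U: "openin X U" "x \<in> U" "finite {A \<in> B. A \<inter> U \<noteq> {}}"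
    "card {A \<in> B. A \<inter> U \<noteq> {}} \<le> 1"
    using assms unfolding discrete_family_def by blast
  have "b = c" if "b \<in> B" "c \<in> B" "b \<inter> U \<noteq> {}" "c \<inter> U \<noteq> {}" for b c
    using card_le_Suc0_iff_eq[OF U(3)] U(4) that by auto
  with U show ?thesis by blast
qed

text \<open>Near a point of \<open>D\<close>, only one member \<open>b\<close> is visible. A closure
  that reaches the neighbourhood \<open>U\<close> comes from a member meeting \<open>U\<close>, so
  different members have disjoint closures. Conversely, the whole of \<open>D \<inter> U\<close>
  lies in the closure of \<open>b\<close>, so the cells are open in \<open>D\<close> even when the
  members of \<open>B\<close> are not open in \<open>X\<close>.\<close>

lemma closure_partition_of_discrete_family:
  assumes B: "discrete_family X B" and D: "D \<subseteq> X closure_of \<Union>B"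
  defines "\<P> \<equiv> (\<lambda>b. D \<inter> X closure_of b) ` B"
  shows "open_cover (subtopology X D) D \<P>" "pairwise disjnt \<P>"
proof -
  have DX: "D \<subseteq> topspace X"
    by (rule order_trans[OF D closure_of_subset_topspace])
  have meets: "b \<inter> U \<noteq> {}" if "openin X U" "z \<in> U" "z \<in> X closure_of b" for U z b
    using that unfolding in_closure_of by blast
  have local: "z \<in> X closure_of b"
    if U: "openin X U" "\<forall>b\<in>B. \<forall>c\<in>B. b \<inter> U \<noteq> {} \<longrightarrow> c \<inter> U \<noteq> {} \<longrightarrow> b = c"
      and b: "b \<in> B" "b \<inter> U \<noteq> {}" and z: "z \<in> D" "z \<in> U" for U b z
  proof -
    \<comment> \<open>Inside \<open>U\<close> the family reduces to \<open>b\<close>, so a point of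
      \<open>U\<close> in the closure of \<open>\<Union>B\<close> is already in the closure of
      \<open>b\<close>.\<close>
    have "\<Union>B \<inter> U \<subseteq> b"
      using U(2) b by blast
    moreover have "z \<in> X closure_of (\<Union>B \<inter> U)"
      using openin_Int_closure_of_subset[OF U(1), of "\<Union>B"] z D by (auto simp: Int_commute)
    ultimately show ?thesis
      using closure_of_mono by blast
  qed
  have cover: "\<exists>b\<in>B. x \<in> X closure_of b" if x: "x \<in> D" for x
  proof -
    obtain U where U: "openin X U" "x \<in> U"
      "\<forall>b\<in>B. \<forall>c\<in>B. b \<inter> U \<noteq> {} \<longrightarrow> c \<inter> U \<noteq> {} \<longrightarrow> b = c"
      using discrete_family_member_unique[OF B subsetD[OF DX x]] by blast
    have "\<Union>B \<inter> U \<noteq> {}"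
      using meets[OF U(1,2)] x D by blast
    then show ?thesis
      using local[OF U(1,3)] U(2) x by blast
  qed
  have "openin (subtopology X D) (D \<inter> X closure_of b)" if b: "b \<in> B" for b
  proof (subst openin_subopen, intro ballI)
    fix x assume x: "x \<in> D \<inter> X closure_of b"
    obtain U where U: "openin X U" "x \<in> U"
      "\<forall>b\<in>B. \<forall>c\<in>B. b \<inter> U \<noteq> {} \<longrightarrow> c \<inter> U \<noteq> {} \<longrightarrow> b = c"
      using discrete_family_member_unique[OF B subsetD[OF DX IntD1[OF x]]] by blast
    have "D \<inter> U \<subseteq> D \<inter> X closure_of b"
      using local[OF U(1,3) b] meets[OF U(1,2)] x by blast
    then show "\<exists>T. openin (subtopology X D) T \<and> x \<in> T \<and> T \<subseteq> D \<inter> X closure_of b"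
      using openin_subtopology_Int2[OF U(1), of D] U(2) x by blast
  qed
  moreover have "D \<subseteq> \<Union>\<P>"
    using cover unfolding \<P>_def by blast
  ultimately show "open_cover (subtopology X D) D \<P>"
    unfolding open_cover_def \<P>_def by blast
  have "b = c" if bc: "b \<in> B" "c \<in> B" and x: "x \<in> D" "x \<in> X closure_of b" "x \<in> X closure_of c"
    for b c x
  proof -
    obtain U where U: "openin X U" "x \<in> U"
      "\<forall>b\<in>B. \<forall>c\<in>B. b \<inter> U \<noteq> {} \<longrightarrow> c \<inter> U \<noteq> {} \<longrightarrow> b = c"
      using discrete_family_member_unique[OF B subsetD[OF DX x(1)]] by blast
    show ?thesis
      using U(3) bc meets[OF U(1,2) x(2)] meets[OF U(1,2) x(3)] by blast
  qed
  then show "pairwise disjnt \<P>"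
    unfolding pairwise_def disjnt_def \<P>_def by blast
qed

text \<open>\<open>K m x\<close> is the cell of \<open>x\<close> in the common refinement of
  \<open>P 0\<close>, ..., \<open>P m\<close>. These cells shrink as \<open>m\<close> grows, and
  \<open>x\<close> takes the first one contained in a member of \<open>\<U>\<close>. All points of
  that cell make the same choice, so the chosen cells form a partition.\<close>

lemma open_partition_refinement:
  assumes P: "\<And>m::nat. open_cover X (topspace X) (P m)" "\<And>m. pairwise disjnt (P m)"
    and small: "\<And>x U. openin X U \<Longrightarrow> x \<in> U \<Longrightarrow> \<exists>m. \<forall>p\<in>P m. x \<in> p \<longrightarrow> p \<subseteq> U"
    and \<U>: "open_cover X (topspace X) \<U>"
  shows "\<exists>\<V>. open_cover X (topspace X) \<V> \<and> pairwise disjnt \<V> \<and> refines \<V> \<U>"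
proof -
  have "\<forall>i. \<forall>x\<in>topspace X. \<exists>p. p \<in> P i \<and> x \<in> p"
    using P(1) unfolding open_cover_def by blast
  then obtain C where C: "\<And>i x. x \<in> topspace X \<Longrightarrow> C i x \<in> P i \<and> x \<in> C i x"
    by metis
  have C_unique: "C i x = p" if "p \<in> P i" "x \<in> p" "x \<in> topspace X" for i x p
    using P(2)[of i] C[OF that(3)] that unfolding pairwise_def disjnt_def by blast
  have open_P: "openin X p" if "p \<in> P i" for i p
    using P(1) that unfolding open_cover_def by blast
  define K where "K m x = (\<Inter>i\<in>{..m}. C i x)" for m x
  define ok where "ok m x \<longleftrightarrow> (\<exists>U\<in>\<U>. K m x \<subseteq> U)" for m x
  define first where "first m x \<longleftrightarrow> ok m x \<and> (\<forall>j<m. \<not> ok j x)" for m x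
  define \<V> where "\<V> = {K m x |m x. x \<in> topspace X \<and> first m x}"
  have K_open: "openin X (K m x)" if "x \<in> topspace X" for m x
    unfolding K_def using C[OF that] open_P by (intro openin_INT2) blast+
  have K_self: "x \<in> K m x" if "x \<in> topspace X" for m x
    unfolding K_def using C[OF that] by auto
  \<comment> \<open>Points sharing a cell at stage \<open>m\<close> share the cells of all earlier
    stages too, so they agree on every test \<open>ok j\<close> with
    \<open>j \<le> m\<close>.\<close>
  have K_eq: "K j x = K j z" if x: "x \<in> topspace X" and z: "z \<in> K m x" and "j \<le> m" for j m x z
  proof -
    have "z \<in> topspace X"
      using K_open[OF x] z openin_subset by blast
    then have "C i x = C i z" if "i \<le> m" for i
      using C_unique[of "C i x" i z] C[OF x] z that unfolding K_def by auto
    then show ?thesis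
      using \<open>j \<le> m\<close> unfolding K_def by auto
  qed
  have first_transfer: "first m z" if "x \<in> topspace X" "first m x" "z \<in> K m x" for m x z
    using K_eq[OF that(1,3)] that(2) unfolding first_def ok_def by (metis le_refl less_imp_le)
  have first_unique: "m = n" if "first m z" "first n z" for m n z
    using that unfolding first_def by (metis nat_neq_iff)
  have "open_cover X (topspace X) \<V>"
    unfolding open_cover_def
  proof (intro conjI ballI subsetI)
    show "openin X V" if "V \<in> \<V>" for V
      using that K_open unfolding \<V>_def by blast
    fix x assume x: "x \<in> topspace X"
    then obtain U where U: "U \<in> \<U>" "x \<in> U" "openin X U"
      using \<U> unfolding open_cover_def by blast
    obtain m where "\<forall>p\<in>P m. x \<in> p \<longrightarrow> p \<subseteq> U"
      using small[OF U(3,2)] by blast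
    then have "C m x \<subseteq> U"
      using C[OF x, of m] by blast
    then have "K m x \<subseteq> U"
      unfolding K_def by blast
    then have "ok m x"
      using U(1) unfolding ok_def by blast
    then have "first (LEAST j. ok j x) x"
      unfolding first_def by (meson LeastI not_less_Least)
    then show "x \<in> \<Union>\<V>"
      using x K_self unfolding \<V>_def by blast
  qed
  moreover have "pairwise disjnt \<V>"
  proof -
    \<comment> \<open>A common point \<open>z\<close> inherits both stages, hence
      \<open>m = n\<close>, and both cells equal \<open>K m z\<close>.\<close>
    have "K m x = K n y"
      if "x \<in> topspace X" "first m x" "y \<in> topspace X" "first n y" "z \<in> K m x" "z \<in> K n y"
      for m n x y z
      using first_unique[OF first_transfer[OF that(1,2,5)] first_transfer[OF that(3,4,6)]]
        K_eq[OF that(1,5) order_refl] K_eq[OF that(3,6) order_refl] by simp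
    then show ?thesis
      unfolding pairwise_def disjnt_def \<V>_def by (simp add: disjoint_iff) blast
  qed
  moreover have "refines \<V> \<U>"
    unfolding refines_def \<V>_def first_def ok_def by blast
  ultimately show ?thesis by blast
qed

text \<open>A node of the tree is the list of indices of ONE's covers, newest first, so that one
  more inning is a \<open>Cons\<close>. The innings themselves come out oldest first, as a strategy
  expects. Lists of naturals make the tree countable.\<close>

definition history :: "'a strategy \<Rightarrow> (nat \<Rightarrow> 'a set set) \<Rightarrow> nat list \<Rightarrow> ('a set set \<times> 'a set set) list"
  where "history \<sigma> \<O> s = foldr (\<lambda>m h. h @ [(\<O> m, \<sigma> h (\<O> m))]) s []"

lemma history_simps [simp]:
  "history \<sigma> \<O> [] = []"
  "history \<sigma> \<O> (m # s) = history \<sigma> \<O> s @ [(\<O> m, \<sigma> (history \<sigma> \<O> s) (\<O> m))]"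
  by (simp_all add: history_def)

text \<open>A strategy is only bound to answer legally after legal innings, so legality is carried
  along \<open>s\<close> by induction.\<close>

lemma legal_two_history:
  assumes "strategy_two X \<sigma>" "\<And>m. legal_one X (\<O> m)"
  shows "legal_two X (\<O> m) (\<sigma> (history \<sigma> \<O> s) (\<O> m))"
proof -
  have "\<forall>(A', B') \<in> set (history \<sigma> \<O> s). legal_one X A' \<and> legal_two X A' B'"
    using assms by (induction s) (auto simp: strategy_two_def)
  then show ?thesis
    using assms unfolding strategy_two_def by blast
qed

lemma winning_strategy_two_covers:
  assumes \<sigma>: "winning_strategy_two X Y \<sigma>" and \<O>: "\<And>m. legal_one X (\<O> m)"
  shows "Y \<subseteq> (\<Union>s. \<Inter>m. \<Union>(\<sigma> (history \<sigma> \<O> s) (\<O> m)))"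
proof
  fix y assume y: "y \<in> Y"
  show "y \<in> (\<Union>s. \<Inter>m. \<Union>(\<sigma> (history \<sigma> \<O> s) (\<O> m)))"
  proof (rule ccontr)
    assume "\<not> ?thesis"
    then have "\<forall>s. \<exists>m. y \<notin> \<Union>(\<sigma> (history \<sigma> \<O> s) (\<O> m))"
      by blast
    then obtain f where f: "\<And>s. y \<notin> \<Union>(\<sigma> (history \<sigma> \<O> s) (\<O> (f s)))"
      by metis
    \<comment> \<open>ONE's counterplay: at each node, play the cover whose index \<open>f\<close>
      selects, so that no answer of TWO ever covers \<open>y\<close>.\<close>
    define s where "s = rec_nat [] (\<lambda>_ t. f t # t)"
    define A where "A n = \<O> (f (s n))" for n
    define B where "B n = \<sigma> (history \<sigma> \<O> (s n)) (A n)" for n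
    have "history \<sigma> \<O> (s n) = map (\<lambda>i. (A i, B i)) [0..<n]" for n
      by (induction n) (auto simp: s_def A_def B_def)
    then have "follows \<sigma> A B"
      unfolding follows_def by (metis B_def)
    moreover have "\<forall>n. legal_one X (A n)"
      by (simp add: A_def \<O>)
    moreover have "(\<forall>n. legal_one X (A n)) \<and> follows \<sigma> A B \<longrightarrow> open_cover X Y (\<Union>n. B n)"
      using \<sigma> unfolding winning_strategy_two_def by (elim conjE allE)
    ultimately have "Y \<subseteq> \<Union>(\<Union>n. B n)"
      by (simp add: open_cover_def)
    then obtain n where "y \<in> \<Union>(B n)"
      using y by blast
    then show False
      using f[of "s n"] by (simp add: A_def B_def)
  qed
qed

text \<open>The closures of the members of \<open>B m\<close> cut \<open>D\<close> into a partition
  by relatively open cells of diameter at most \<open>2 / (m + 1)\<close>, so these partitions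
  eventually isolate each point within any given neighbourhood.\<close>

lemma (in Metric_space) strongly_zero_dimensional_discrete_closures:
  fixes B :: "nat \<Rightarrow> 'a set set"
  assumes B: "\<And>m. discrete_family mtopology (B m)"
    and small: "\<And>m. refines (B m) ((\<lambda>x. mball x (1 / real (Suc m))) ` M)"
  defines "D \<equiv> \<Inter>m. mtopology closure_of \<Union>(B m)"
  shows "strongly_zero_dimensional (subtopology mtopology D)"
proof -
  let ?P = "\<lambda>m. (\<lambda>b. D \<inter> mtopology closure_of b) ` B m"
  have D: "D \<subseteq> mtopology closure_of \<Union>(B m)" for m
    unfolding D_def by blast
  have top: "topspace (subtopology mtopology D) = D"
    using D[of 0] closure_of_subset_topspace by fastforce
  have diam: "d x y \<le> 2 / real (Suc m)"
    if b: "b \<in> B m" and xy: "x \<in> mtopology closure_of b" "y \<in> mtopology closure_of b" for b m x y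
  proof -
    obtain c where "c \<in> M" "b \<subseteq> mball c (1 / real (Suc m))"
      using small[of m] b unfolding refines_def by blast
    \<comment> \<open>Closed balls absorb the closure without a larger radius; two radii give the
      bound on the diameter.\<close>
    then have "mtopology closure_of b \<subseteq> mcball c (1 / real (Suc m))"
      by (meson closure_of_minimal closedin_mcball mball_subset_mcball order_trans)
    then have "x \<in> M" "y \<in> M" "c \<in> M" "d c x \<le> 1 / real (Suc m)" "d c y \<le> 1 / real (Suc m)"
      using xy by (auto simp: in_mcball)
    then show ?thesis
      using triangle[of x c y] commute[of x c] add_divide_distrib[of 1 1 "real (Suc m)"] by simp
  qed
  have "\<exists>m. \<forall>p\<in>?P m. x \<in> p \<longrightarrow> p \<subseteq> V"
    if V: "openin (subtopology mtopology D) V" "x \<in> V" for x V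
  proof -
    obtain W where W: "openin mtopology W" "V = W \<inter> D"
      using V(1) by (auto simp: openin_subtopology)
    then obtain e where e: "e > 0" "mball x e \<subseteq> W"
      using V(2) by (auto simp: openin_mtopology)
    obtain m where "1 / real (Suc m) < e / 2"
      using e(1) by (meson half_gt_zero nat_approx_posE)
    then have m: "2 / real (Suc m) < e"
      by (simp add: field_simps)
    have "D \<inter> mtopology closure_of b \<subseteq> V" if b: "b \<in> B m" "x \<in> mtopology closure_of b" for b
    proof
      fix y assume y: "y \<in> D \<inter> mtopology closure_of b"
      have "x \<in> M" "y \<in> M"
        using b(2) y by (auto simp: in_closure_of)
      then have "y \<in> mball x e"
        using diam[OF b] y m by (force simp: in_mball)
      then show "y \<in> V"
        using e W y by blast
    qed
    then show ?thesis by blast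
  qed
  moreover have "open_cover (subtopology mtopology D) (topspace (subtopology mtopology D)) (?P m)"
    for m
    unfolding top by (rule closure_partition_of_discrete_family(1)[OF B D])
  moreover have "pairwise disjnt (?P m)" for m
    by (rule closure_partition_of_discrete_family(2)[OF B D])
  ultimately show ?thesis
    unfolding strongly_zero_dimensional_def
    by (intro allI impI open_partition_refinement[where P = ?P]) auto
qed

theorem theorem15:
  fixes X :: "'a topology" and Y :: "'a set"
  assumes "metrizable_space X"
    and "infinite (topspace X)"
    and "Y \<subseteq> topspace X"
    and "\<exists>\<sigma>. winning_strategy_two X Y \<sigma>"
  shows "\<exists>\<C>. countable \<C> \<and>
           (\<forall>C\<in>\<C>. closedin X C \<and> strongly_zero_dimensional (subtopology X C)) \<and>
           Y \<subseteq> \<Union>\<C>"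
proof -
  obtain M d where "Metric_space M d" and X: "X = Metric_space.mtopology M d"
    using assms(1) unfolding metrizable_space_def by blast
  then interpret Metric_space M d by blast
  obtain \<sigma> where \<sigma>: "winning_strategy_two X Y \<sigma>"
    using assms(4) by blast
  define \<O> where "\<O> m = (\<lambda>x. mball x (1 / real (Suc m))) ` M" for m
  have \<O>: "legal_one X (\<O> m)" for m
    unfolding legal_one_def open_cover_def \<O>_def X by force
  define B where "B s m = \<sigma> (history \<sigma> \<O> s) (\<O> m)" for s m
  have "legal_two X (\<O> m) (B s m)" for s m
    unfolding B_def using \<sigma> \<O> by (intro legal_two_history) (auto simp: winning_strategy_two_def)
  then have discrete: "discrete_family X (B s m)" and small: "refines (B s m) (\<O> m)" for s m
    by (auto simp: legal_two_def)
  \<comment> \<open>Taking closures before intersecting makes the sets closed and only enlarges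
    them, so they still cover \<open>Y\<close>.\<close>
  define D where "D s = (\<Inter>m. X closure_of \<Union>(B s m))" for s
  have "closedin X (D s)" for s
    unfolding D_def by (intro closedin_INT) auto
  moreover have "strongly_zero_dimensional (subtopology X (D s))" for s
    using strongly_zero_dimensional_discrete_closures[of "B s"] discrete small
    unfolding D_def X \<O>_def by blast
  moreover have "Y \<subseteq> \<Union>(range D)"
  proof -
    have "\<Union>(B s m) \<subseteq> X closure_of \<Union>(B s m)" for s m
      using discrete[of s m] by (intro closure_of_subset) (simp add: discrete_family_def)
    then have "(\<Inter>m. \<Union>(B s m)) \<subseteq> D s" for s
      unfolding D_def by (intro INF_mono) blast
    then have "(\<Union>s. \<Inter>m. \<Union>(B s m)) \<subseteq> \<Union>(range D)"
      by (intro UN_mono order_refl)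
    then show ?thesis
      unfolding B_def by (rule order_trans[OF winning_strategy_two_covers[OF \<sigma> \<O>]])
  qed
  moreover have "countable (range D)"
    by blast
  ultimately show ?thesis by blast
qed

end
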